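(* Let $I\subset\mathbb{R}$ be an open interval and let $\alpha:I\to E^3$ be a unit speed rectifying slant helix with curvature $\kappa$ and torsion $\tau$, whose principal normal vector field $n$ makes a constant angle $\theta$ with a fixed unit vector $u$, i.e. $g(n(s),u)=\cos(\theta)$ for all $s\in I$. Then there exist constants $c_1\neq 0$ and $c_2$ in $\mathbb{R}$ such that for all $s\in I$ $$\kappa(s)=\frac{|c_1\tan(\theta)|}{\left((c_1s+c_2)^2+1\right)^{3/2}},\qquad \tau(s)=\frac{|c_1\tan(\theta)|\,(c_1s+c_2)}{\left((c_1s+c_2)^2+1\right)^{3/2}}.$$
   Context: $E^3$ is $\mathbb{R}^3$ with the Euclidean metric $g$. Curves are unit speed (parametrized by arclength $s$, $g(\alpha',\alpha')=1$), have at least four continuous derivatives, and satisfy $t'(s)\neq 0$ for all $s$ (where $t=\alpha'$), so that the Frenet frame $\{t,n,b\}$ is defined, with $t'=\kappa n$, $n'=-\kappa t+\tau b$, $b'=-\tau n$, and $\kappa>0$. A curve is a slant helix if its principal normal vector field $n$ makes a constant angle with a fixed line in space, i.e. there is a fixed unit vector $u$ with $g(n(s),u)$ constant. A rectifying slant helix is a unit speed slant helix whose position vector always lies in its rectifying plane, i.e. $\alpha(s)=\lambda(s)t(s)+\mu(s)b(s)$ for some functions $\lambda,\mu$. *)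

theory Defs
  imports "HOL-Analysis.Analysis"
begin

text \<open>Curves are total functions \<open>real \<Rightarrow> real ^ 3\<close> considered on an open parameter set \<open>I\<close> only.
  At the points of an open set, \<open>vector_derivative\<close> does not depend on the values outside of it.\<close>

definition deriv_curve :: "(real \<Rightarrow> real ^ 3) \<Rightarrow> real \<Rightarrow> real ^ 3" where
  "deriv_curve f s = vector_derivative f (at s)"

text \<open>\<open>C_k_curve_on k f I\<close>: on the open set \<open>I\<close>, the curve \<open>f\<close> has \<open>k\<close> continuous derivatives.\<close>

fun C_k_curve_on :: "nat \<Rightarrow> (real \<Rightarrow> real ^ 3) \<Rightarrow> real set \<Rightarrow> bool" where
  "C_k_curve_on 0 f I \<longleftrightarrow> continuous_on I f"
| "C_k_curve_on (Suc k) f I \<longleftrightarrow> f differentiable_on I \<and> C_k_curve_on k (deriv_curve f) I"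

definition tangent :: "(real \<Rightarrow> real ^ 3) \<Rightarrow> real \<Rightarrow> real ^ 3" where
  "tangent \<alpha> = deriv_curve \<alpha>"

definition curvature :: "(real \<Rightarrow> real ^ 3) \<Rightarrow> real \<Rightarrow> real" where
  "curvature \<alpha> s = norm (deriv_curve (tangent \<alpha>) s)"

definition principal_normal :: "(real \<Rightarrow> real ^ 3) \<Rightarrow> real \<Rightarrow> real ^ 3" where
  "principal_normal \<alpha> s = deriv_curve (tangent \<alpha>) s /\<^sub>R curvature \<alpha> s"

definition binormal :: "(real \<Rightarrow> real ^ 3) \<Rightarrow> real \<Rightarrow> real ^ 3" where
  "binormal \<alpha> s = cross3 (tangent \<alpha> s) (principal_normal \<alpha> s)"

text \<open>For a Frenet curve the derivative of the binormal \<open>b\<close> is a multiple of the unit vector \<open>n\<close>;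
  the sign convention is \<open>b' = - \<tau> n\<close>.\<close>

definition torsion :: "(real \<Rightarrow> real ^ 3) \<Rightarrow> real \<Rightarrow> real" where
  "torsion \<alpha> s = - (deriv_curve (binormal \<alpha>) s \<bullet> principal_normal \<alpha> s)"

definition unit_speed_frenet_curve :: "(real \<Rightarrow> real ^ 3) \<Rightarrow> real set \<Rightarrow> bool" where
  "unit_speed_frenet_curve \<alpha> I \<longleftrightarrow>
     C_k_curve_on 4 \<alpha> I \<and>
     (\<forall>s\<in>I. tangent \<alpha> s \<bullet> tangent \<alpha> s = 1) \<and>
     (\<forall>s\<in>I. deriv_curve (tangent \<alpha>) s \<noteq> 0)"

definition slant_helix :: "(real \<Rightarrow> real ^ 3) \<Rightarrow> real set \<Rightarrow> bool" where
  "slant_helix \<alpha> I \<longleftrightarrow>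
     unit_speed_frenet_curve \<alpha> I \<and>
     (\<exists>u c. norm u = 1 \<and> (\<forall>s\<in>I. principal_normal \<alpha> s \<bullet> u = c))"

definition rectifying_slant_helix :: "(real \<Rightarrow> real ^ 3) \<Rightarrow> real set \<Rightarrow> bool" where
  "rectifying_slant_helix \<alpha> I \<longleftrightarrow>
     slant_helix \<alpha> I \<and>
     (\<exists>l m :: real \<Rightarrow> real.
        \<forall>s\<in>I. \<alpha> s = l s *\<^sub>R tangent \<alpha> s + m s *\<^sub>R binormal \<alpha> s)"

end

theory Submission
  imports Defs
begin

text \<open>
  Write \<open>t, n, b\<close> for the Frenet frame of \<open>\<alpha>\<close>, so that \<open>t' = \<kappa> n\<close>, \<open>n' = - \<kappa> t + \<tau> b\<close> and
  \<open>b' = - \<tau> n\<close>.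

  A rectifying curve satisfies \<open>\<alpha> \<bullet> n = 0\<close>. Hence \<open>(\<alpha> \<bullet> t)' = 1\<close> and \<open>(\<alpha> \<bullet> b)' = 0\<close>, so
  \<open>\<alpha> \<bullet> t = s + a\<close> and \<open>\<alpha> \<bullet> b = m\<close> with constants \<open>a\<close> and \<open>m\<close>; differentiating \<open>\<alpha> \<bullet> n = 0\<close> gives
  \<open>\<tau> m = \<kappa> (s + a)\<close>, which forces \<open>m \<noteq> 0\<close>. So \<open>w = \<tau> / \<kappa> = (s + a) / m\<close> is an affine function of
  arclength (lemma \<open>rectifying_curve_torsion_curvature_ratio\<close>).

  For the fixed direction \<open>u\<close> put \<open>\<beta> = b \<bullet> u\<close>. Differentiating \<open>n \<bullet> u = cos \<theta>\<close> gives
  \<open>t \<bullet> u = w \<beta>\<close>, and differentiating this once more gives \<open>\<kappa> cos \<theta> (1 + w\<^sup>2) = w' \<beta>\<close>. The size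
  of \<open>\<beta>\<close> comes from \<open>norm u = 1\<close>: expanding \<open>u\<close> in the frame, \<open>\<beta>\<^sup>2 (1 + w\<^sup>2) = sin\<^sup>2 \<theta>\<close>.
  Eliminating \<open>\<beta>\<close> yields \<open>\<kappa> = \<bar>w' tan \<theta>\<bar> / (1 + w\<^sup>2) powr (3 / 2)\<close>, and \<open>\<tau> = w \<kappa>\<close>. So
  \<open>c1 = 1 / m\<close> and \<open>c2 = a / m\<close>.
\<close>

section \<open>Orthonormal frames and derivatives of inner products\<close>

lemma orthonormal_cross3_expansion:
  fixes t n x :: "real ^ 3"
  assumes "t \<bullet> t = 1" "n \<bullet> n = 1" "t \<bullet> n = 0"
  shows "x = (x \<bullet> t) *\<^sub>R t + (x \<bullet> n) *\<^sub>R n + (x \<bullet> cross3 t n) *\<^sub>R cross3 t n"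
proof -
  let ?b = "cross3 t n"
  have bt: "cross3 ?b t = n"
    by (subst cross_skew) (simp add: Lagrange assms)
  have bn: "cross3 ?b n = - t"
    by (subst cross_skew) (simp add: Lagrange assms inner_commute[of n t])
  have "?b \<bullet> ?b = 1"
    by (simp add: dot_cross assms inner_commute[of n t])
  \<comment> \<open>Evaluate \<open>b \<times> (x \<times> b)\<close> by the triple product rule in two ways.\<close>
  then have "x - (x \<bullet> ?b) *\<^sub>R ?b = cross3 ?b (cross3 x ?b)"
    by (simp add: Lagrange[of ?b x ?b] inner_commute[of ?b x])
  also have "cross3 x ?b = (x \<bullet> n) *\<^sub>R t - (x \<bullet> t) *\<^sub>R n"
    by (rule Lagrange)
  also have "cross3 ?b \<dots> = (x \<bullet> t) *\<^sub>R t + (x \<bullet> n) *\<^sub>R n"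
    by (simp add: Cross3.right_diff_distrib cross_mult_right bt bn)
  finally show ?thesis by (simp add: algebra_simps)
qed

lemma has_vector_derivative_inner:
  fixes f g :: "real \<Rightarrow> 'a::real_inner"
  assumes "(f has_vector_derivative f') (at s)" "(g has_vector_derivative g') (at s)"
  shows "((\<lambda>x. f x \<bullet> g x) has_vector_derivative (f s \<bullet> g' + f' \<bullet> g s)) (at s)"
  using bounded_bilinear.has_vector_derivative[OF bounded_bilinear_inner assms] by simp

lemma derivative_zero_if_constant_on_open:
  fixes f :: "real \<Rightarrow> 'a::real_normed_vector"
  assumes "open I" "s \<in> I" "\<And>x. x \<in> I \<Longrightarrow> f x = k" "(f has_vector_derivative f') (at s)"
  shows "f' = 0"
proof -
  have "((\<lambda>_. k) has_vector_derivative f') (at s)"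
    using has_vector_derivative_transform_within_open[OF assms(4,1,2)] assms(3) by simp
  then show ?thesis
    by (metis has_vector_derivative_const vector_derivative_at)
qed

lemma inner_derivative_zero_if_constant_on_open:
  fixes f g :: "real \<Rightarrow> 'a::real_inner"
  assumes "open I" "s \<in> I" "\<And>x. x \<in> I \<Longrightarrow> f x \<bullet> g x = k"
    and "(f has_vector_derivative f') (at s)" "(g has_vector_derivative g') (at s)"
  shows "f s \<bullet> g' + f' \<bullet> g s = 0"
  using derivative_zero_if_constant_on_open[OF assms(1-3) has_vector_derivative_inner[OF assms(4,5)]] .

lemma constant_if_derivative_zero_on_interval:
  fixes f :: "real \<Rightarrow> real"
  assumes "is_interval I" "\<And>s. s \<in> I \<Longrightarrow> (f has_vector_derivative 0) (at s)"
  obtains c where "\<And>s. s \<in> I \<Longrightarrow> f s = c"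
proof -
  have "\<exists>c. \<forall>s\<in>I. f s = c"
  proof (rule has_field_derivative_zero_constant)
    show "convex I" using assms(1) is_interval_convex by blast
    show "(f has_field_derivative 0) (at s within I)" if "s \<in> I" for s
      using assms(2)[OF that] has_vector_derivative_at_within
      by (simp add: has_real_derivative_iff_has_vector_derivative)
  qed
  then show ?thesis using that by blast
qed

section \<open>The Frenet equations\<close>

lemma deriv_curve_works:
  assumes "f differentiable_on I" "open I" "s \<in> I"
  shows "(f has_vector_derivative deriv_curve f s) (at s)"
  using assms unfolding deriv_curve_def
  by (metis differentiable_on_eq_differentiable_at vector_derivative_works)

lemma frenet_curve_derivatives:
  assumes "unit_speed_frenet_curve \<alpha> I" "open I" "s \<in> I"
  shows "(\<alpha> has_vector_derivative tangent \<alpha> s) (at s)"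
    and "(tangent \<alpha> has_vector_derivative deriv_curve (tangent \<alpha>) s) (at s)"
    and "(deriv_curve (tangent \<alpha>) has_vector_derivative
            deriv_curve (deriv_curve (tangent \<alpha>)) s) (at s)"
  using assms
  by (auto simp: unit_speed_frenet_curve_def tangent_def numeral_eq_Suc intro!: deriv_curve_works)

lemma frenet_curve_tangent:
  assumes "unit_speed_frenet_curve \<alpha> I" "open I" "s \<in> I"
  shows "curvature \<alpha> s > 0"
    and "(tangent \<alpha> has_vector_derivative curvature \<alpha> s *\<^sub>R principal_normal \<alpha> s) (at s)"
  using assms frenet_curve_derivatives(2)[OF assms]
  by (auto simp: unit_speed_frenet_curve_def curvature_def principal_normal_def)

lemma frenet_frame_orthonormal:
  assumes "unit_speed_frenet_curve \<alpha> I" "open I" "s \<in> I"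
  shows "tangent \<alpha> s \<bullet> tangent \<alpha> s = 1"
    and "principal_normal \<alpha> s \<bullet> principal_normal \<alpha> s = 1"
    and "tangent \<alpha> s \<bullet> principal_normal \<alpha> s = 0"
    and "binormal \<alpha> s \<bullet> binormal \<alpha> s = 1"
    and "tangent \<alpha> s \<bullet> binormal \<alpha> s = 0"
    and "principal_normal \<alpha> s \<bullet> binormal \<alpha> s = 0"
proof -
  show tt: "tangent \<alpha> s \<bullet> tangent \<alpha> s = 1"
    using assms by (simp add: unit_speed_frenet_curve_def)
  have "deriv_curve (tangent \<alpha>) s \<noteq> 0"
    using assms by (simp add: unit_speed_frenet_curve_def)
  then show nn: "principal_normal \<alpha> s \<bullet> principal_normal \<alpha> s = 1"
    by (simp add: principal_normal_def curvature_def dot_square_norm power2_eq_square field_simps)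
  have "tangent \<alpha> s \<bullet> (curvature \<alpha> s *\<^sub>R principal_normal \<alpha> s)
      + (curvature \<alpha> s *\<^sub>R principal_normal \<alpha> s) \<bullet> tangent \<alpha> s = 0"
    using inner_derivative_zero_if_constant_on_open[OF assms(2,3) _
        frenet_curve_tangent(2)[OF assms] frenet_curve_tangent(2)[OF assms]] assms(1)
    by (auto simp: unit_speed_frenet_curve_def)
  then show tn: "tangent \<alpha> s \<bullet> principal_normal \<alpha> s = 0"
    using frenet_curve_tangent(1)[OF assms] by (simp add: inner_commute)
  show "binormal \<alpha> s \<bullet> binormal \<alpha> s = 1"
    using tt nn tn by (simp add: binormal_def dot_cross inner_commute)
qed (simp_all add: binormal_def dot_cross_self)

lemma frenet_frame_expansion:
  assumes "unit_speed_frenet_curve \<alpha> I" "open I" "s \<in> I"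
  shows "x = (x \<bullet> tangent \<alpha> s) *\<^sub>R tangent \<alpha> s + (x \<bullet> principal_normal \<alpha> s) *\<^sub>R principal_normal \<alpha> s
           + (x \<bullet> binormal \<alpha> s) *\<^sub>R binormal \<alpha> s"
  unfolding binormal_def
  by (rule orthonormal_cross3_expansion) (use frenet_frame_orthonormal[OF assms] in auto)

lemma principal_normal_derivative_exists:
  assumes "unit_speed_frenet_curve \<alpha> I" "open I" "s \<in> I"
  obtains n' where "(principal_normal \<alpha> has_vector_derivative n') (at s)"
proof -
  let ?T = "deriv_curve (tangent \<alpha>)"
  have T: "?T differentiable (at s)"
    using frenet_curve_derivatives(3)[OF assms] by (rule differentiableI_vector)
  have "?T s \<noteq> 0"
    using assms by (simp add: unit_speed_frenet_curve_def)
  then have "(\<lambda>x. norm (?T x)) differentiable (at s)"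
    using differentiable_compose[of norm ?T s UNIV] T by simp
  then have "(\<lambda>x. ?T x /\<^sub>R norm (?T x)) differentiable (at s)"
    using T \<open>?T s \<noteq> 0\<close> by (intro differentiable_scaleR differentiable_inverse) auto
  then show ?thesis
    using that by (auto simp: principal_normal_def[abs_def] curvature_def vector_derivative_works)
qed

text \<open>The derivative \<open>n'\<close> of the normal is determined by its coordinates in the frame, which come
  from differentiating the orthonormality relations; the torsion is defined through \<open>b'\<close>, so the
  third coordinate uses \<open>n \<bullet> b = 0\<close>. Then \<open>b' = t' \<times> n + t \<times> n'\<close>.\<close>

lemma frenet_equations_normal_binormal:
  assumes "unit_speed_frenet_curve \<alpha> I" "open I" "s \<in> I"
  shows "(principal_normal \<alpha> has_vector_derivative
            (torsion \<alpha> s *\<^sub>R binormal \<alpha> s - curvature \<alpha> s *\<^sub>R tangent \<alpha> s)) (at s)"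
    and "(binormal \<alpha> has_vector_derivative - (torsion \<alpha> s *\<^sub>R principal_normal \<alpha> s)) (at s)"
proof -
  note t' = frenet_curve_tangent(2)[OF assms]
  note frame = frenet_frame_orthonormal[OF assms(1,2)]
  obtain n' where n': "(principal_normal \<alpha> has_vector_derivative n') (at s)"
    using principal_normal_derivative_exists[OF assms] .
  have bilin: "bounded_bilinear cross3"
    using bilinear_cross by (rule bilinear_conv_bounded_bilinear[THEN iffD1])
  have b': "(binormal \<alpha> has_vector_derivative cross3 (tangent \<alpha> s) n') (at s)"
    using bounded_bilinear.has_vector_derivative[OF bilin t' n']
    by (simp add: binormal_def[abs_def] cross_mult_left)
  have nt: "n' \<bullet> tangent \<alpha> s = - curvature \<alpha> s"
    using inner_derivative_zero_if_constant_on_open[OF assms(2,3) frame(3) t' n'] frame(2)[OF assms(3)]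
    by (simp add: inner_commute)
  have nn: "n' \<bullet> principal_normal \<alpha> s = 0"
    using inner_derivative_zero_if_constant_on_open[OF assms(2,3) frame(2) n' n']
    by (simp add: inner_commute)
  have "deriv_curve (binormal \<alpha>) s = cross3 (tangent \<alpha> s) n'"
    unfolding deriv_curve_def by (rule vector_derivative_at[OF b'])
  then have nb: "n' \<bullet> binormal \<alpha> s = torsion \<alpha> s"
    using inner_derivative_zero_if_constant_on_open[OF assms(2,3) frame(6) n' b']
    by (simp add: torsion_def inner_commute)
  have n'_eq: "n' = torsion \<alpha> s *\<^sub>R binormal \<alpha> s - curvature \<alpha> s *\<^sub>R tangent \<alpha> s"
    using frenet_frame_expansion[OF assms, of n'] by (simp add: nt nn nb)
  have "cross3 (tangent \<alpha> s) (binormal \<alpha> s) = - principal_normal \<alpha> s"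
    using frame[OF assms(3)] by (simp add: binormal_def Lagrange)
  then have "cross3 (tangent \<alpha> s) n' = - (torsion \<alpha> s *\<^sub>R principal_normal \<alpha> s)"
    by (simp add: n'_eq Cross3.right_diff_distrib cross_mult_right)
  with n' n'_eq b' show
    "(principal_normal \<alpha> has_vector_derivative
        (torsion \<alpha> s *\<^sub>R binormal \<alpha> s - curvature \<alpha> s *\<^sub>R tangent \<alpha> s)) (at s)"
    "(binormal \<alpha> has_vector_derivative - (torsion \<alpha> s *\<^sub>R principal_normal \<alpha> s)) (at s)"
    by simp_all
qed

section \<open>Rectifying curves\<close>

lemma rectifying_curve_torsion_curvature_ratio:
  assumes frenet: "unit_speed_frenet_curve \<alpha> I" and I: "open I" "is_interval I" "I \<noteq> {}"
    and rect: "\<And>s. s \<in> I \<Longrightarrow> \<alpha> s \<bullet> principal_normal \<alpha> s = 0"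
  obtains a m where "m \<noteq> 0" "\<And>s. s \<in> I \<Longrightarrow> torsion \<alpha> s * m = curvature \<alpha> s * (s + a)"
proof -
  note d\<alpha> = frenet_curve_derivatives(1)[OF frenet I(1)]
  note dt = frenet_curve_tangent(2)[OF frenet I(1)]
  note dn = frenet_equations_normal_binormal(1)[OF frenet I(1)]
  note db = frenet_equations_normal_binormal(2)[OF frenet I(1)]
  note frame = frenet_frame_orthonormal[OF frenet I(1)]
  have "((\<lambda>x. \<alpha> x \<bullet> tangent \<alpha> x - x) has_vector_derivative 0) (at s)" if "s \<in> I" for s
    using has_vector_derivative_diff[OF has_vector_derivative_inner[OF d\<alpha> dt]
        has_vector_derivative_id, OF that that] rect[OF that] frame(1)[OF that] by simp
  then obtain a where a: "\<And>s. s \<in> I \<Longrightarrow> \<alpha> s \<bullet> tangent \<alpha> s - s = a"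
    using constant_if_derivative_zero_on_interval[OF I(2)] by blast
  have "((\<lambda>x. \<alpha> x \<bullet> binormal \<alpha> x) has_vector_derivative 0) (at s)" if "s \<in> I" for s
    using has_vector_derivative_inner[OF d\<alpha> db, OF that that] rect[OF that] frame(5)[OF that] by simp
  then obtain m where m: "\<And>s. s \<in> I \<Longrightarrow> \<alpha> s \<bullet> binormal \<alpha> s = m"
    using constant_if_derivative_zero_on_interval[OF I(2)] by blast
  have rel: "torsion \<alpha> s * m = curvature \<alpha> s * (s + a)" if "s \<in> I" for s
    using inner_derivative_zero_if_constant_on_open[OF I(1) that rect d\<alpha> dn, OF _ that that]
      frame(3)[OF that] m[OF that] a[OF that]
    by (simp add: inner_diff_right algebra_simps)
  have "m \<noteq> 0"
  proof
    assume "m = 0"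
    \<comment> \<open>Then \<open>s + a\<close> would vanish on the nonempty open set \<open>I\<close>, although its derivative is 1.\<close>
    then have zero: "x = - a" if "x \<in> I" for x
      using rel[OF that] frenet_curve_tangent(1)[OF frenet I(1) that] by simp
    obtain s where "s \<in> I" using I(3) by blast
    from derivative_zero_if_constant_on_open[OF I(1) this zero has_vector_derivative_id]
    show False by simp
  qed
  with rel show ?thesis using that by blast
qed

section \<open>Slant helices with affine ratio of torsion and curvature\<close>

text \<open>Differentiating \<open>n \<bullet> u = c\<close> gives the first identity, and \<open>m\<close> times the derivative of the
  first gives the second. For \<open>m \<noteq> 0\<close> and \<open>w = (s + a) / m\<close> they say \<open>t \<bullet> u = w (b \<bullet> u)\<close> and
  \<open>\<kappa> c (1 + w\<^sup>2) = w' (b \<bullet> u)\<close>; without denominators they can be differentiated directly.\<close>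

lemma slant_helix_direction_coordinates:
  assumes frenet: "unit_speed_frenet_curve \<alpha> I" and I: "open I" "s \<in> I"
    and slant: "\<And>s. s \<in> I \<Longrightarrow> principal_normal \<alpha> s \<bullet> u = c"
    and ratio: "\<And>s. s \<in> I \<Longrightarrow> torsion \<alpha> s * m = curvature \<alpha> s * (s + a)"
  shows "m * (tangent \<alpha> s \<bullet> u) = (s + a) * (binormal \<alpha> s \<bullet> u)"
    and "curvature \<alpha> s * c * (m\<^sup>2 + (s + a)\<^sup>2) = m * (binormal \<alpha> s \<bullet> u)"
proof -
  note dt = frenet_curve_tangent(2)[OF frenet I(1)]
  note dn = frenet_equations_normal_binormal(1)[OF frenet I(1)]
  note db = frenet_equations_normal_binormal(2)[OF frenet I(1)]
  have du: "((\<lambda>_. u) has_vector_derivative 0) (at x)" for x :: real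
    by (rule has_vector_derivative_const)
  have first: "m * (tangent \<alpha> x \<bullet> u) = (x + a) * (binormal \<alpha> x \<bullet> u)" if x: "x \<in> I" for x
  proof -
    have "torsion \<alpha> x * (binormal \<alpha> x \<bullet> u) = curvature \<alpha> x * (tangent \<alpha> x \<bullet> u)"
      using inner_derivative_zero_if_constant_on_open[OF I(1) x slant dn[OF x] du]
      by (simp add: inner_diff_left)
    then have "curvature \<alpha> x * (m * (tangent \<alpha> x \<bullet> u))
        = (torsion \<alpha> x * m) * (binormal \<alpha> x \<bullet> u)"
      by (simp add: algebra_simps)
    also have "\<dots> = curvature \<alpha> x * ((x + a) * (binormal \<alpha> x \<bullet> u))"
      by (simp add: ratio[OF x])
    finally show ?thesis
      using frenet_curve_tangent(1)[OF frenet I(1) x] by simp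
  qed
  show "m * (tangent \<alpha> s \<bullet> u) = (s + a) * (binormal \<alpha> s \<bullet> u)"
    using first I(2) .
  let ?v = "\<lambda>x. m *\<^sub>R tangent \<alpha> x - (x + a) *\<^sub>R binormal \<alpha> x"
  have dv: "(?v has_vector_derivative
      ((m * curvature \<alpha> s) *\<^sub>R principal_normal \<alpha> s
        - (binormal \<alpha> s - ((s + a) * torsion \<alpha> s) *\<^sub>R principal_normal \<alpha> s))) (at s)"
    by (auto intro!: derivative_eq_intros dt db I)
  have "?v x \<bullet> u = 0" if "x \<in> I" for x
    using first[OF that] by (simp add: inner_diff_left)
  then have "m * curvature \<alpha> s * c + (s + a) * torsion \<alpha> s * c = binormal \<alpha> s \<bullet> u"
    using inner_derivative_zero_if_constant_on_open[OF I _ dv du] slant[OF I(2)]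
    by (simp add: inner_diff_left)
  then have "m * (binormal \<alpha> s \<bullet> u) = m * (m * curvature \<alpha> s * c + (s + a) * torsion \<alpha> s * c)"
    by simp
  also have "\<dots> = curvature \<alpha> s * c * m\<^sup>2 + (s + a) * c * (torsion \<alpha> s * m)"
    by (simp add: algebra_simps power2_eq_square)
  also have "\<dots> = curvature \<alpha> s * c * (m\<^sup>2 + (s + a)\<^sup>2)"
    unfolding ratio[OF I(2)] by (simp add: algebra_simps power2_eq_square)
  finally show "curvature \<alpha> s * c * (m\<^sup>2 + (s + a)\<^sup>2) = m * (binormal \<alpha> s \<bullet> u)"
    by (rule sym)
qed

text \<open>The elimination of \<open>\<beta>\<close>. If \<open>cos \<theta> = 0\<close>, the first equation would force \<open>\<beta> = 0\<close>, against the
  second one; so \<open>tan \<theta>\<close> is a genuine quotient.\<close>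

lemma curvature_from_direction_coordinates:
  fixes k w c1 \<beta> \<theta> :: real
  assumes "k > 0" "c1 \<noteq> 0"
    and k: "k * cos \<theta> * (w\<^sup>2 + 1) = c1 * \<beta>"
    and \<beta>: "\<beta>\<^sup>2 * (w\<^sup>2 + 1) = (sin \<theta>)\<^sup>2"
  shows "k = \<bar>c1 * tan \<theta>\<bar> / (w\<^sup>2 + 1) powr (3 / 2)"
proof -
  define W where "W = w\<^sup>2 + 1"
  have W: "W > 0" unfolding W_def by (simp add: add_nonneg_pos)
  have cos: "cos \<theta> \<noteq> 0"
  proof
    assume "cos \<theta> = 0"
    with k \<open>c1 \<noteq> 0\<close> have "\<beta> = 0" by simp
    with \<beta> \<open>cos \<theta> = 0\<close> show False using sin_cos_squared_add[of \<theta>] by simp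
  qed
  have "\<bar>\<beta>\<bar> * sqrt W = \<bar>sin \<theta>\<bar>"
    using arg_cong[OF \<beta>, of sqrt] by (simp add: W_def real_sqrt_mult)
  moreover have "k * \<bar>cos \<theta>\<bar> * W = \<bar>c1\<bar> * \<bar>\<beta>\<bar>"
    using arg_cong[OF k, of abs] \<open>k > 0\<close> W by (simp add: W_def abs_mult)
  ultimately have "k * \<bar>cos \<theta>\<bar> * (W * sqrt W) = \<bar>c1\<bar> * \<bar>sin \<theta>\<bar>"
    by (metis mult.assoc)
  moreover have "W powr (3 / 2) = W * sqrt W"
    using W powr_add[of W 1 "1/2"] by (simp add: powr_half_sqrt)
  ultimately have "k * W powr (3 / 2) = \<bar>c1 * tan \<theta>\<bar>"
    using cos by (simp add: tan_def abs_mult field_simps)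
  then show ?thesis
    unfolding W_def[symmetric] using W by (simp add: field_simps)
qed

theorem theorem4:
  fixes I :: "real set" and \<alpha> :: "real \<Rightarrow> real ^ 3" and u :: "real ^ 3" and \<theta> :: real
  assumes "open I" and "is_interval I"
    and "rectifying_slant_helix \<alpha> I"
    and "norm u = 1"
    and "\<forall>s\<in>I. principal_normal \<alpha> s \<bullet> u = cos \<theta>"
  shows "\<exists>c1 c2 :: real. c1 \<noteq> 0 \<and>
    (\<forall>s\<in>I.
       curvature \<alpha> s = \<bar>c1 * tan \<theta>\<bar> / ((c1 * s + c2)\<^sup>2 + 1) powr (3 / 2) \<and>
       torsion \<alpha> s = \<bar>c1 * tan \<theta>\<bar> * (c1 * s + c2) / ((c1 * s + c2)\<^sup>2 + 1) powr (3 / 2))"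
proof (cases "I = {}")
  case True
  then show ?thesis by (intro exI[of _ 1]) simp
next
  case False
  have frenet: "unit_speed_frenet_curve \<alpha> I"
    using assms(3) by (simp add: rectifying_slant_helix_def slant_helix_def)
  from assms(3) obtain l m :: "real \<Rightarrow> real"
    where position: "\<forall>s\<in>I. \<alpha> s = l s *\<^sub>R tangent \<alpha> s + m s *\<^sub>R binormal \<alpha> s"
    unfolding rectifying_slant_helix_def by (elim conjE exE)
  have rect: "\<alpha> s \<bullet> principal_normal \<alpha> s = 0" if "s \<in> I" for s
    using frenet_frame_orthonormal(3,6)[OF frenet assms(1) that]
    by (simp add: bspec[OF position that] inner_add_left inner_commute[of "binormal \<alpha> s"])
  obtain a m where m: "m \<noteq> 0"
    and ratio: "\<And>s. s \<in> I \<Longrightarrow> torsion \<alpha> s * m = curvature \<alpha> s * (s + a)"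
    using rectifying_curve_torsion_curvature_ratio[OF frenet assms(1,2) False rect] by blast
  have "curvature \<alpha> s = \<bar>1 / m * tan \<theta>\<bar> / ((1 / m * s + a / m)\<^sup>2 + 1) powr (3 / 2) \<and>
      torsion \<alpha> s = \<bar>1 / m * tan \<theta>\<bar> * (1 / m * s + a / m)
        / ((1 / m * s + a / m)\<^sup>2 + 1) powr (3 / 2)"
    if s: "s \<in> I" for s
  proof -
    define w where "w = 1 / m * s + a / m"
    define \<beta> where "\<beta> = binormal \<alpha> s \<bullet> u"
    have sa: "s + a = w * m" using m by (simp add: w_def field_simps)
    have slant: "principal_normal \<alpha> x \<bullet> u = cos \<theta>" if "x \<in> I" for x
      using assms(5) that by blast
    note coords = slant_helix_direction_coordinates[OF frenet assms(1) s slant ratio]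
    have tu: "tangent \<alpha> s \<bullet> u = w * \<beta>"
      using coords(1) m by (simp add: sa \<beta>_def)
    have "m * (m * (curvature \<alpha> s * cos \<theta> * (w\<^sup>2 + 1))) = m * \<beta>"
      using coords(2) unfolding sa \<beta>_def by (simp add: algebra_simps power2_eq_square)
    then have k: "curvature \<alpha> s * cos \<theta> * (w\<^sup>2 + 1) = 1 / m * \<beta>"
      using m by (simp add: nonzero_eq_divide_eq ac_simps)
    have "1 = u \<bullet> u"
      using assms(4) by (simp add: dot_square_norm)
    also have "\<dots> = (tangent \<alpha> s \<bullet> u)\<^sup>2 + (principal_normal \<alpha> s \<bullet> u)\<^sup>2 + (binormal \<alpha> s \<bullet> u)\<^sup>2"
      using arg_cong[OF frenet_frame_expansion[OF frenet assms(1) s, of u], of "\<lambda>x. x \<bullet> u"]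
      by (simp add: inner_add_left inner_add_right inner_commute power2_eq_square)
    also have "\<dots> = (w * \<beta>)\<^sup>2 + (cos \<theta>)\<^sup>2 + \<beta>\<^sup>2"
      by (simp add: tu slant[OF s] \<beta>_def)
    finally have "\<beta>\<^sup>2 * (w\<^sup>2 + 1) = (sin \<theta>)\<^sup>2"
      by (simp add: sin_squared_eq algebra_simps)
    then have curv: "curvature \<alpha> s = \<bar>1 / m * tan \<theta>\<bar> / (w\<^sup>2 + 1) powr (3 / 2)"
      using curvature_from_direction_coordinates[OF _ _ k] m
        frenet_curve_tangent(1)[OF frenet assms(1) s] by simp
    have "torsion \<alpha> s = curvature \<alpha> s * w"
      using ratio[OF s] m by (simp add: sa)
    with curv show ?thesis
      unfolding w_def[symmetric] by simp
  qed
  moreover have "1 / m \<noteq> 0"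
    using m by simp
  ultimately show ?thesis by blast
qed

end
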